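(* Let $\mathcal{F}$ be a second-countable, locally compact Hausdorff space and let $\mathcal{L} : \mathcal{F}\times\mathcal{F} \to [0,\infty)$ be a Lagrangian which is continuous and of compact range. For each $x\in\mathcal{F}$ let $K_x\subset\mathcal{F}$ be a compact set such that $\mathcal{L}(x,y)=0$ for all $y\notin K_x$. Moreover, assume that the following conditions hold: (a) $c:=\inf_{x\in\mathcal{F}}\mathcal{L}(x,x)>0$. (b) $\sup_{x,y\in\mathcal{F}}\mathcal{L}(x,y)\le\mathscr{C}<\infty$. (c) There is an integer $N>0$ such that every $K_x$ can be covered by open sets $U_1,\ldots,U_N$ with the property that for all $i\in\{1,\ldots,N\}$, $$\mathcal{L}(x,y)>\frac{c}{2}\qquad\text{for all } y\in U_i\,.$$ Let $\rho$ be a Borel measure on $\mathcal{F}$ obtained by the exhaustion construction described in the context. Then $\mathcal{L}(x,\cdot)$ is $\rho$-integrable for all $x\in\mathcal{F}$ and $$\sup_{x\in\mathcal{F}}\int_{\mathcal{F}}\mathcal{L}(x,y)\,d\rho(y)<\infty\,.$$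
   Context: A Borel measure is a locally finite measure on the Borel $\sigma$-algebra $\mathcal{B}(\mathcal{F})$ with values in $[0,\infty]$. Lagrangian: a symmetric, lower semi-continuous function $\mathcal{L}:\mathcal{F}\times\mathcal{F}\to[0,\infty)$ with $\mathcal{L}(x,x)>0$ for all $x\in\mathcal{F}$. It has compact range if for every compact $K\subset\mathcal{F}$ there is a compact $K'\subset\mathcal{F}$ such that $\mathcal{L}(x,y)=0$ for all $x\in K$ and $y\notin K'$. Exhaustion construction. For compact $K\subset\mathcal{F}$ let $\mathfrak{M}_K$ be the set of Borel measures $\mu$ on $K$ with $\mu(K)=1$, and $\mathcal{S}_K(\mu)=\int_K\int_K\mathcal{L}(x,y)\,d\mu(x)\,d\mu(y)$; minimizers of $\mathcal{S}_K$ in $\mathfrak{M}_K$ exist for nonempty $K$. Let $(K_n)_{n\in\mathbb{N}}$ be an exhaustion of $\mathcal{F}$ by nonempty compact sets with $K_n\subset K_{n+1}^\circ$ and $\bigcup_n K_n=\mathcal{F}$. For each $n$ let $\mu_n\in\mathfrak{M}_{K_n}$ be a minimizer of $\mathcal{S}_{K_n}$, put $\mathfrak{s}_n:=\inf_{x\in K_n}\int_{K_n}\mathcal{L}(x,y)\,d\mu_n(y)>0$, $\lambda_n:=1/\mathfrak{s}_n$, and $\rho^{[n]}(A):=\lambda_n\,\mu_n(A\cap K_n)$ for $A\in\mathcal{B}(\mathcal{F})$. With this scaling, $\int_{\mathcal{F}}\mathcal{L}(x,y)\,d\rho^{[n]}(y)\ge 1$ for all $x\in K_n$, with equality on $\operatorname{supp}\rho^{[n]}$.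 The sequence $(\rho^{[n]}(K))_n$ is bounded for each compact $K$; by a diagonal argument one chooses a subsequence, denoted $(\rho^{(k)})_{k\in\mathbb{N}}$ (with the exhaustion relabeled so that $\rho^{(k)}$ is the rescaled minimizer on $K_k$), such that for every $m$ the restrictions $\rho^{(k)}|_{K_m}$ converge weakly as $k\to\infty$. Then $\rho$ is the (unique) Radon measure on $\mathcal{F}$ which is the vague limit of $(\rho^{(k)})$, i.e. $\int f\,d\rho^{(k)}\to\int f\,d\rho$ for all $f\in C_c(\mathcal{F})$.
   Formalization: Condition (c) is taken as L(x',y) > c/2 for all x',y in U_i (both points running over U_i), not with x fixed as the base point of K_x; with x fixed the claim is false (discrete union of star graphs with growing numbers of leaves). *)

theory Defs
  imports "HOL-Analysis.Analysis"
begin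

section \<open>Lagrangians\<close>

definition lower_semicontinuous :: "('b::topological_space \<Rightarrow> real) \<Rightarrow> bool" where
  "lower_semicontinuous f \<longleftrightarrow> (\<forall>p a. a < f p \<longrightarrow> (\<forall>\<^sub>F q in nhds p. a < f q))"

definition lagrangian :: "('a::topological_space \<Rightarrow> 'a \<Rightarrow> real) \<Rightarrow> bool" where
  "lagrangian L \<longleftrightarrow>
     (\<forall>x y. 0 \<le> L x y) \<and> (\<forall>x y. L x y = L y x) \<and>
     lower_semicontinuous (\<lambda>(x, y). L x y) \<and> (\<forall>x. 0 < L x x)"

definition compact_range :: "('a::topological_space \<Rightarrow> 'a \<Rightarrow> real) \<Rightarrow> bool" where
  "compact_range L \<longleftrightarrow>
     (\<forall>K. compact K \<longrightarrow> (\<exists>K'. compact K' \<and> (\<forall>x\<in>K. \<forall>y. y \<notin> K' \<longrightarrow> L x y = 0)))"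

text \<open>In \<open>covered_by_cells L r N A\<close> both arguments of \<open>L\<close> range over the same covering set.
  Keeping one argument fixed at the point \<open>x\<close> with \<open>A = K\<^sub>x\<close> would make \<open>N\<close> irrelevant
  (merge the \<open>N\<close> sets into one) and would not bound the integrals: let \<open>F\<close> be the discrete
  disjoint union of the star graphs with \<open>n \<ge> 1\<close> leaves and \<open>L x y = 1\<close> if \<open>x = y\<close> or \<open>x\<close>, \<open>y\<close>
  are adjacent, \<open>L x y = 0\<close> otherwise. Exhausting by the first \<open>n\<close> stars can produce the counting
  measure on the leaves, for which the centre of the \<open>n\<close>-th star has integral \<open>n\<close>.\<close>

definition covered_by_cells ::
    "('a::topological_space \<Rightarrow> 'a \<Rightarrow> real) \<Rightarrow> real \<Rightarrow> nat \<Rightarrow> 'a set \<Rightarrow> bool" where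
  "covered_by_cells L r N A \<longleftrightarrow>
     (\<exists>U :: nat \<Rightarrow> 'a set.
        A \<subseteq> (\<Union>i\<in>{1..N}. U i) \<and>
        (\<forall>i\<in>{1..N}. open (U i) \<and> (\<forall>x\<in>U i. \<forall>y\<in>U i. r < L x y)))"

section \<open>Radon measures, weak and vague convergence\<close>

definition locally_finite_measure :: "'a::topological_space measure \<Rightarrow> bool" where
  "locally_finite_measure M \<longleftrightarrow> (\<forall>x. \<exists>U. open U \<and> x \<in> U \<and> emeasure M U < \<infinity>)"

definition borel_measure :: "'a::topological_space measure \<Rightarrow> bool" where
  "borel_measure M \<longleftrightarrow> sets M = sets borel \<and> locally_finite_measure M"

definition radon_measure :: "'a::topological_space measure \<Rightarrow> bool" where
  "radon_measure M \<longleftrightarrow>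
     borel_measure M \<and>
     (\<forall>A\<in>sets borel. emeasure M A = (SUP C\<in>{C. compact C \<and> C \<subseteq> A}. emeasure M C))"

definition vague_limit ::
    "(nat \<Rightarrow> 'a::topological_space measure) \<Rightarrow> 'a measure \<Rightarrow> bool" where
  "vague_limit M N \<longleftrightarrow>
     (\<forall>f :: 'a \<Rightarrow> real. continuous_on UNIV f \<and> compact (closure {x. f x \<noteq> 0}) \<longrightarrow>
        (\<lambda>k. \<integral>x. f x \<partial>M k) \<longlonglongrightarrow> (\<integral>x. f x \<partial>N))"

text \<open>Weak convergence of finite Borel measures living on the subspace \<open>S\<close>.\<close>

definition weakly_convergent_on ::
    "'a::topological_space set \<Rightarrow> (nat \<Rightarrow> 'a measure) \<Rightarrow> bool" where
  "weakly_convergent_on S M \<longleftrightarrow>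
     (\<exists>N. finite_measure N \<and> sets N = sets (restrict_space borel S) \<and>
        (\<forall>f :: 'a \<Rightarrow> real. continuous_on S f \<and> bounded (f ` S) \<longrightarrow>
           (\<lambda>k. \<integral>x. f x \<partial>M k) \<longlonglongrightarrow> (\<integral>x. f x \<partial>N)))"

section \<open>The exhaustion construction\<close>

text \<open>Members of \<open>normalized_measures K\<close> are measures on the subspace \<open>K\<close>, i.e.\ with
  \<open>space \<mu> = K\<close>, so that integrals against \<open>\<mu>\<close> are integrals over \<open>K\<close>.\<close>

definition normalized_measures :: "'a::topological_space set \<Rightarrow> 'a measure set" where
  "normalized_measures K = {\<mu>. sets \<mu> = sets (restrict_space borel K) \<and> emeasure \<mu> K = 1}"

definition action :: "('a \<Rightarrow> 'a \<Rightarrow> real) \<Rightarrow> 'a measure \<Rightarrow> ennreal" where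
  "action L \<mu> = (\<integral>\<^sup>+ y. \<integral>\<^sup>+ x. ennreal (L x y) \<partial>\<mu> \<partial>\<mu>)"

definition action_minimizer ::
    "('a::topological_space \<Rightarrow> 'a \<Rightarrow> real) \<Rightarrow> 'a set \<Rightarrow> 'a measure \<Rightarrow> bool" where
  "action_minimizer L K \<mu> \<longleftrightarrow>
     \<mu> \<in> normalized_measures K \<and> (\<forall>\<nu>\<in>normalized_measures K. action L \<mu> \<le> action L \<nu>)"

definition scaling_parameter :: "('a \<Rightarrow> 'a \<Rightarrow> real) \<Rightarrow> 'a set \<Rightarrow> 'a measure \<Rightarrow> ennreal" where
  "scaling_parameter L K \<mu> = (INF x\<in>K. \<integral>\<^sup>+ y. ennreal (L x y) \<partial>\<mu>)"

text \<open>The push-forward along the inclusion of \<open>K\<close> is \<open>A \<mapsto> \<mu> (A \<inter> K)\<close>.\<close>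

definition rescaled_extension ::
    "('a::topological_space \<Rightarrow> 'a \<Rightarrow> real) \<Rightarrow> 'a set \<Rightarrow> 'a measure \<Rightarrow> 'a measure" where
  "rescaled_extension L K \<mu> =
     scale_measure (1 / scaling_parameter L K \<mu>) (distr \<mu> borel (\<lambda>x. x))"

definition compact_exhaustion :: "(nat \<Rightarrow> 'a::topological_space set) \<Rightarrow> bool" where
  "compact_exhaustion K \<longleftrightarrow>
     (\<forall>n. compact (K n) \<and> K n \<noteq> {} \<and> K n \<subseteq> interior (K (Suc n))) \<and> (\<Union>n. K n) = UNIV"

text \<open>\<open>\<rho>\<close> arises from some exhaustion \<open>K\<close>, some choice \<open>\<mu>\<close> of minimizers and some subsequence
  \<open>r\<close>. The compact sets on which the restrictions converge weakly are those of the relabelled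
  exhaustion \<open>K \<circ> r\<close>.\<close>

definition obtained_by_exhaustion ::
    "('a::topological_space \<Rightarrow> 'a \<Rightarrow> real) \<Rightarrow> 'a measure \<Rightarrow> bool" where
  "obtained_by_exhaustion L \<rho> \<longleftrightarrow>
     (\<exists>(K :: nat \<Rightarrow> 'a set) (\<mu> :: nat \<Rightarrow> 'a measure) (r :: nat \<Rightarrow> nat).
        compact_exhaustion K \<and>
        (\<forall>n. action_minimizer L (K n) (\<mu> n)) \<and>
        strict_mono r \<and>
        (let \<rho>_seq = (\<lambda>k. rescaled_extension L (K (r k)) (\<mu> (r k))) in
           (\<forall>m. weakly_convergent_on (K (r m)) (\<lambda>k. restrict_space (\<rho>_seq k) (K (r m)))) \<and>
           radon_measure \<rho> \<and> vague_limit \<rho>_seq \<rho>))"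

end

theory Submission
  imports Defs "HOL-Probability.Probability_Mass_Function"
begin

text \<open>Perturbing a minimizer \<open>\<mu>\<close> on \<open>K\<close> towards a Dirac measure at \<open>x\<close> shows that the potential
  \<open>\<integral> L x y \<partial>\<mu>(y)\<close> is at least the action of \<open>\<mu>\<close> for every \<open>x \<in> K\<close>. Since the \<open>\<mu>\<close>-average of the
  potential is the action, the potential equals its infimum \<open>\<s>\<close> almost everywhere. A set \<open>U\<close>
  with \<open>L > c / 2\<close> on \<open>U \<times> U\<close> and positive measure thus contains a point of potential \<open>\<s>\<close>, so
  \<open>c / 2 * \<mu> U \<le> \<s>\<close>, i.e.\ the rescaled measure of \<open>U\<close> is at most \<open>2 / c\<close>. Covering \<open>K\<^sub>x\<close> by
  \<open>N\<close> such sets bounds the integrals of \<open>L x\<close> by \<open>2 * N * C / c\<close> along the exhaustion, and the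
  bound passes to the vague limit because \<open>L x\<close> is continuous with compact support.\<close>

section \<open>Normalized measures on a subspace and measurability of the potential\<close>

lemma normalized_measuresD:
  assumes "\<mu> \<in> normalized_measures K"
  shows "sets \<mu> = sets (restrict_space borel K)" "space \<mu> = K" "prob_space \<mu>"
proof -
  show s: "sets \<mu> = sets (restrict_space borel K)"
    using assms by (simp add: normalized_measures_def)
  then show sp: "space \<mu> = K"
    using sets_eq_imp_space_eq[OF s] by (simp add: space_restrict_space)
  show "prob_space \<mu>"
    by (rule prob_spaceI) (use assms sp in \<open>simp add: normalized_measures_def\<close>)
qed

lemma measurable_restrict_borel:
  assumes "f \<in> borel \<rightarrow>\<^sub>M N" "sets \<mu> = sets (restrict_space borel K)"
  shows "f \<in> \<mu> \<rightarrow>\<^sub>M N"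
  using measurable_restrict_space1[OF assms(1)] measurable_cong_sets[OF assms(2) refl] by blast

context
  fixes L :: "'a::{second_countable_topology, t2_space} \<Rightarrow> 'a \<Rightarrow> real"
    and K :: "'a set" and \<mu> :: "'a measure" and B :: real
  assumes L_nonneg: "\<And>x y. 0 \<le> L x y"
    and L_sym: "\<And>x y. L x y = L y x"
    and L_le: "\<And>x y. L x y \<le> B"
    and L_meas: "(\<lambda>(x, y). L x y) \<in> borel_measurable borel"
    and minimizer: "action_minimizer L K \<mu>"
begin

lemma minimizer_normalized: "\<mu> \<in> normalized_measures K"
  using minimizer by (simp add: action_minimizer_def)

lemmas minimizer_props = normalized_measuresD[OF minimizer_normalized]

text \<open>Second countability identifies the Borel sets of the product with the product
  \<sigma>-algebra, so joint measurability survives restriction to \<open>K\<close> in each factor.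
  The arguments of \<open>L\<close> are swapped to match the inner integral in
  \<open>action\<close>.\<close>

lemma L_measurable_pair:
  assumes "sets \<nu> = sets (restrict_space borel K)" "sets \<nu>' = sets (restrict_space borel K)"
  shows "(\<lambda>(y, z). ennreal (L z y)) \<in> borel_measurable (\<nu> \<Otimes>\<^sub>M \<nu>')"
proof -
  have m: "(\<lambda>x. x) \<in> \<nu> \<rightarrow>\<^sub>M borel" "(\<lambda>x. x) \<in> \<nu>' \<rightarrow>\<^sub>M borel"
    using measurable_restrict_borel[OF measurable_ident_sets[OF refl]] assms by auto
  have "(\<lambda>p. (snd p, fst p)) \<in> (\<nu> \<Otimes>\<^sub>M \<nu>') \<rightarrow>\<^sub>M (borel \<Otimes>\<^sub>M borel)"
    using m by (auto intro!: measurable_Pair measurable_compose[OF measurable_fst]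
        measurable_compose[OF measurable_snd])
  moreover have "(\<lambda>(x, y). L x y) \<in> borel_measurable (borel \<Otimes>\<^sub>M borel)"
    using L_meas by (simp add: borel_prod)
  ultimately have "(\<lambda>p. L (snd p) (fst p)) \<in> borel_measurable (\<nu> \<Otimes>\<^sub>M \<nu>')"
    using measurable_compose by force
  then show ?thesis by (simp add: case_prod_beta)
qed

lemma L_measurable_left: "(\<lambda>y. ennreal (L x y)) \<in> borel_measurable borel"
proof -
  have "(\<lambda>(x, y). L x y) \<in> borel_measurable (borel \<Otimes>\<^sub>M borel)"
    using L_meas by (simp add: borel_prod)
  from measurable_Pair2[OF this, of x] show ?thesis by simp
qed

lemma potential_measurable:
  assumes "sets \<nu> = sets (restrict_space borel K)" "prob_space \<nu>"
  shows "(\<lambda>y. \<integral>\<^sup>+ z. ennreal (L z y) \<partial>\<nu>) \<in> borel_measurable \<nu>"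
proof -
  interpret prob_space \<nu> by fact
  show ?thesis
    using borel_measurable_nn_integral[OF L_measurable_pair[OF assms(1) assms(1)]] by simp
qed

lemma nn_integral_le_bound:
  assumes "prob_space \<nu>" "\<And>y. f y \<le> ennreal B"
  shows "(\<integral>\<^sup>+ y. f y \<partial>\<nu>) \<le> ennreal B"
proof -
  interpret prob_space \<nu> by fact
  have "(\<integral>\<^sup>+ y. f y \<partial>\<nu>) \<le> (\<integral>\<^sup>+ y. ennreal B \<partial>\<nu>)"
    by (rule nn_integral_mono) (use assms in auto)
  then show ?thesis by (simp add: emeasure_space_1)
qed

section \<open>First variation of the action\<close>

text \<open>Write \<open>a\<close> for the action and \<open>l\<close> for the potential at
  \<open>x\<close>. The mixture of the Dirac measure at \<open>x\<close> with weight
  \<open>p\<close> and \<mu> with weight \<open>1 - p\<close> has action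
  \<open>p^2 * L x x + 2 * p * (1 - p) * l + (1 - p)^2 * a\<close>. This is at least
  \<open>a\<close>; dividing by \<open>p\<close> and letting \<open>p\<close> tend to 0 leaves
  \<open>2 * a \<le> 2 * l\<close>.\<close>

lemma action_le_potential:
  assumes x: "x \<in> K"
  shows "action L \<mu> \<le> (\<integral>\<^sup>+ y. ennreal (L x y) \<partial>\<mu>)"
proof -
  interpret mu: prob_space \<mu> by (rule minimizer_props)
  define f where "f y = (\<integral>\<^sup>+ z. ennreal (L z y) \<partial>\<mu>)" for y
  have f_le: "f y \<le> ennreal B" for y
    unfolding f_def by (intro nn_integral_le_bound minimizer_props ennreal_leI L_le)
  have S_le: "action L \<mu> \<le> ennreal B"
    unfolding action_def
    by (intro nn_integral_le_bound minimizer_props ennreal_leI L_le)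
  \<comment> \<open>Both quantities are at most \<open>B\<close>, hence finite, and the quadratic in
    \<open>p\<close> can be rearranged over the reals.\<close>
  define a where "a = enn2real (action L \<mu>)"
  define l where "l = enn2real (f x)"
  have a: "action L \<mu> = ennreal a"
    using S_le unfolding a_def by (metis ennreal_enn2real ennreal_less_top le_less_trans)
  have l: "f x = ennreal l"
    using f_le unfolding l_def by (metis ennreal_enn2real ennreal_less_top le_less_trans)
  have nn: "0 \<le> a" "0 \<le> l" by (auto simp: a_def l_def)
  have fx: "f x = (\<integral>\<^sup>+ y. ennreal (L x y) \<partial>\<mu>)"
    unfolding f_def by (simp add: L_sym)
  have main: "2 * a - p * a \<le> 2 * (1 - p) * l + p * L x x" if p: "0 < p" "p < 1" for p
  proof -
    \<comment> \<open>The mixture is built as a two-stage experiment: a Bernoulli variable selects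
      the Dirac measure with probability \<open>p\<close> and \<mu> otherwise. Integrals against
      \<nu> then split by \<open>nn_integral_bind\<close>.\<close>
    define \<kappa> where "\<kappa> b = (if b then return \<mu> x else \<mu>)" for b
    define \<nu> where "\<nu> = measure_pmf (bernoulli_pmf p) \<bind> \<kappa>"
    have xs: "x \<in> space \<mu>" using x minimizer_props by simp
    have \<kappa>: "\<kappa> \<in> measure_pmf (bernoulli_pmf p) \<rightarrow>\<^sub>M subprob_algebra \<mu>"
      using mu.subprob_space_axioms prob_space_imp_subprob_space[OF prob_space_return[OF xs]]
      by (simp add: \<kappa>_def space_subprob_algebra)
    have sets\<nu>: "sets \<nu> = sets \<mu>"
      unfolding \<nu>_def by (rule sets_bind) (auto simp: \<kappa>_def)
    have int\<nu>: "(\<integral>\<^sup>+ y. g y \<partial>\<nu>) = ennreal p * g x + ennreal (1 - p) * (\<integral>\<^sup>+ y. g y \<partial>\<mu>)"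
      if g: "g \<in> borel_measurable \<mu>" for g
    proof -
      have "(\<integral>\<^sup>+ y. g y \<partial>\<nu>) = (\<integral>\<^sup>+ b. (\<integral>\<^sup>+ y. g y \<partial>\<kappa> b) \<partial>measure_pmf (bernoulli_pmf p))"
        unfolding \<nu>_def by (rule nn_integral_bind[OF g \<kappa>])
      also have "\<dots> = ennreal p * g x + ennreal (1 - p) * (\<integral>\<^sup>+ y. g y \<partial>\<mu>)"
        using p g xs by (simp add: \<kappa>_def nn_integral_return mult.commute)
      finally show ?thesis .
    qed
    have em: "emeasure \<nu> K = 1"
    proof -
      have "(\<integral>\<^sup>+ y. 1 \<partial>\<nu>) = ennreal p + ennreal (1 - p)"
        by (subst int\<nu>) (auto simp: mu.emeasure_space_1)
      also have "\<dots> = 1" using p by (simp flip: ennreal_plus)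
      finally show ?thesis
        using sets_eq_imp_space_eq[OF sets\<nu>] minimizer_props(2) by simp
    qed
    have \<nu>N: "\<nu> \<in> normalized_measures K"
      using em sets\<nu> minimizer_props(1) by (simp add: normalized_measures_def)
    note \<nu>D = normalized_measuresD[OF \<nu>N]
    have Lm: "(\<lambda>z. ennreal (L z y)) \<in> borel_measurable \<mu>" for y
      unfolding L_sym[of _ y]
      by (rule measurable_restrict_borel[OF L_measurable_left minimizer_props(1)])
    have inner: "(\<integral>\<^sup>+ z. ennreal (L z y) \<partial>\<nu>) = ennreal p * ennreal (L x y) + ennreal (1 - p) * f y" for y
      unfolding f_def by (rule int\<nu>[OF Lm])
    have Lm': "(\<lambda>y. ennreal (L x y)) \<in> borel_measurable \<mu>"
      unfolding L_sym[of x] by (rule Lm)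
    have fm: "f \<in> borel_measurable \<mu>"
      using potential_measurable[OF minimizer_props(1) minimizer_props(3)] unfolding f_def .
    have int_f: "(\<integral>\<^sup>+ y. f y \<partial>\<mu>) = action L \<mu>" by (simp add: action_def f_def)
    have "action L \<nu> = (\<integral>\<^sup>+ y. ennreal p * ennreal (L x y) + ennreal (1 - p) * f y \<partial>\<nu>)"
      by (simp add: action_def inner)
    also have "\<dots> = ennreal p * (ennreal p * ennreal (L x x) + ennreal (1 - p) * f x)
        + ennreal (1 - p) * (\<integral>\<^sup>+ y. ennreal p * ennreal (L x y) + ennreal (1 - p) * f y \<partial>\<mu>)"
      by (intro int\<nu> borel_measurable_add borel_measurable_times_ennreal Lm' fm) simp_all
    also have "(\<integral>\<^sup>+ y. ennreal p * ennreal (L x y) + ennreal (1 - p) * f y \<partial>\<mu>)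
        = ennreal p * f x + ennreal (1 - p) * action L \<mu>"
      using Lm' fm by (simp add: nn_integral_add nn_integral_cmult int_f fx)
    finally have "action L \<nu> = ennreal (p * (p * L x x + (1 - p) * l) + (1 - p) * (p * l + (1 - p) * a))"
      using p nn L_nonneg[of x x] by (simp add: a l ennreal_mult)
    moreover have "action L \<mu> \<le> action L \<nu>"
      using minimizer \<nu>N by (simp add: action_minimizer_def)
    ultimately have "a \<le> p * (p * L x x + (1 - p) * l) + (1 - p) * (p * l + (1 - p) * a)"
      using p nn L_nonneg[of x x] by (simp add: a del: ennreal_plus)
    then have "p * (2 * a - p * a) \<le> p * (2 * (1 - p) * l + p * L x x)"
      by (simp add: algebra_simps power2_eq_square)
    then show ?thesis using p by simp
  qed
  \<comment> \<open>The zeros stay unsimplified so that both sides are literally the values at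
    \<open>p = 0\<close> produced by the limit rules.\<close>
  have "2 * a - 0 * a \<le> 2 * (1 - 0) * l + 0 * L x x"
  proof (rule tendsto_le[of "at_right (0::real)"])
    show "((\<lambda>p. 2 * a - p * a) \<longlongrightarrow> 2 * a - 0 * a) (at_right 0)"
      by (intro tendsto_intros)
    show "((\<lambda>p. 2 * (1 - p) * l + p * L x x) \<longlongrightarrow> 2 * (1 - 0) * l + 0 * L x x) (at_right 0)"
      by (intro tendsto_intros)
    show "\<forall>\<^sub>F p in at_right 0. 2 * a - p * a \<le> 2 * (1 - p) * l + p * L x x"
      using eventually_at_right_less[of "0::real"] eventually_at_right_field[of _ "0::real"]
      by (metis (mono_tags, lifting) main zero_less_one)
  qed simp
  then show ?thesis using a l fx nn by simp
qed

text \<open>The infimum of the potential is at least the action by the first variation, and at most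
  the average of the potential, which is again the action. A function bounded below by its own
  finite average equals it almost everywhere.\<close>

lemma AE_potential_eq_scaling: "AE x in \<mu>. (\<integral>\<^sup>+ y. ennreal (L x y) \<partial>\<mu>) = scaling_parameter L K \<mu>"
proof -
  interpret mu: prob_space \<mu> by (rule minimizer_props)
  define f where "f x = (\<integral>\<^sup>+ y. ennreal (L x y) \<partial>\<mu>)" for x
  define S where "S = action L \<mu>"
  have fm: "f \<in> borel_measurable \<mu>"
    using potential_measurable[OF minimizer_props(1) minimizer_props(3)] unfolding f_def by (simp add: L_sym)
  have int_f: "(\<integral>\<^sup>+ x. f x \<partial>\<mu>) = S"
    by (simp add: S_def action_def f_def L_sym)
  have f_ge: "S \<le> f x" if "x \<in> K" for x
    using action_le_potential[OF that] by (simp add: S_def f_def)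
  have S_le: "S \<le> ennreal B"
    unfolding S_def action_def
    by (intro nn_integral_le_bound minimizer_props ennreal_leI L_le)
  have s_ge: "S \<le> scaling_parameter L K \<mu>"
    unfolding scaling_parameter_def using f_ge by (auto simp: f_def intro: INF_greatest)
  have s_le: "scaling_parameter L K \<mu> \<le> f x" if "x \<in> K" for x
    unfolding scaling_parameter_def f_def using that by (rule INF_lower)
  have "(\<integral>\<^sup>+ x. scaling_parameter L K \<mu> \<partial>\<mu>) \<le> (\<integral>\<^sup>+ x. f x \<partial>\<mu>)"
    using s_le minimizer_props by (intro nn_integral_mono) auto
  then have s: "scaling_parameter L K \<mu> = S"
    using s_ge by (simp add: int_f mu.emeasure_space_1)
  \<comment> \<open>Subtraction in \<open>ennreal\<close> is truncated; splitting the integral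
    relies on \<open>S \<le> f\<close> on \<open>K\<close> and on \<open>S\<close> being
    finite.\<close>
  have "(\<integral>\<^sup>+ x. f x - S \<partial>\<mu>) = (\<integral>\<^sup>+ x. f x \<partial>\<mu>) - (\<integral>\<^sup>+ x. S \<partial>\<mu>)"
    by (rule nn_integral_diff)
      (use fm f_ge S_le minimizer_props in \<open>auto simp: mu.emeasure_space_1 top_unique intro!: AE_I2\<close>)
  also have "\<dots> = 0"
    using S_le by (cases S) (auto simp: int_f mu.emeasure_space_1 top_unique)
  finally have "AE x in \<mu>. f x - S = 0"
    using fm by (subst (asm) nn_integral_0_iff_AE) auto
  then show ?thesis using AE_space
  proof eventually_elim
    fix x assume "f x - S = 0" "x \<in> space \<mu>"
    then have "f x \<le> S"
      by (simp add: diff_eq_0_iff_ennreal)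
    then show "(\<integral>\<^sup>+ y. ennreal (L x y) \<partial>\<mu>) = scaling_parameter L K \<mu>"
      using f_ge \<open>x \<in> space \<mu>\<close> minimizer_props(2) s by (auto simp: f_def intro: antisym)
  qed
qed

section \<open>Mass bounds for cells, uniform along the exhaustion\<close>

lemma cell_mass_le:
  assumes U: "open U" "\<And>x y. x \<in> U \<Longrightarrow> y \<in> U \<Longrightarrow> r < L x y" and r: "0 < r"
  shows "emeasure (rescaled_extension L K \<mu>) U \<le> ennreal (1 / r)"
proof -
  define s where "s = scaling_parameter L K \<mu>"
  have id: "(\<lambda>x. x) \<in> \<mu> \<rightarrow>\<^sub>M borel"
    by (rule measurable_restrict_borel[OF measurable_ident_sets[OF refl] minimizer_props(1)])
  have Us: "U \<inter> K \<in> sets \<mu>"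
    using U(1) by (simp add: minimizer_props sets_restrict_space) (auto simp: image_iff)
  have le: "ennreal r * emeasure \<mu> (U \<inter> K) \<le> s"
  proof (cases "emeasure \<mu> (U \<inter> K) = 0")
    case False
    \<comment> \<open>A set of positive measure is not contained in the exceptional null
      set.\<close>
    have "\<exists>x\<in>U \<inter> K. (\<integral>\<^sup>+ y. ennreal (L x y) \<partial>\<mu>) = s"
    proof (rule ccontr)
      assume "\<not> ?thesis"
      then have "AE x in \<mu>. x \<notin> U \<inter> K"
        using AE_potential_eq_scaling by (auto simp: s_def elim!: eventually_mono)
      then show False
        using False AE_iff_null_sets[OF Us] by auto
    qed
    then obtain x where x: "x \<in> U" "(\<integral>\<^sup>+ y. ennreal (L x y) \<partial>\<mu>) = s" by blast
    have "ennreal r * emeasure \<mu> (U \<inter> K) = (\<integral>\<^sup>+ y. ennreal r * indicator (U \<inter> K) y \<partial>\<mu>)"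
      using Us by (simp add: nn_integral_cmult_indicator)
    also have "\<dots> \<le> (\<integral>\<^sup>+ y. ennreal (L x y) \<partial>\<mu>)"
      using less_imp_le[OF U(2)[OF x(1)]]
      by (intro nn_integral_mono) (auto simp: indicator_def intro!: ennreal_leI)
    finally show ?thesis using x by simp
  qed simp
  have "emeasure (rescaled_extension L K \<mu>) U = 1 / s * emeasure \<mu> (U \<inter> K)"
    using U(1) id by (simp add: rescaled_extension_def s_def emeasure_distr minimizer_props(2))
  also have "\<dots> \<le> 1 / s * (s * ennreal (1 / r))"
  proof (rule mult_left_mono)
    have "emeasure \<mu> (U \<inter> K) = (ennreal r * emeasure \<mu> (U \<inter> K)) * ennreal (1 / r)"
    proof -
      have "ennreal r * ennreal (1 / r) = 1" using r by (simp flip: ennreal_mult)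
      then show ?thesis by (metis mult.assoc mult.commute mult_1)
    qed
    also have "\<dots> \<le> s * ennreal (1 / r)" using le by (rule mult_right_mono) simp
    finally show "emeasure \<mu> (U \<inter> K) \<le> s * ennreal (1 / r)" .
  qed simp
  also have "\<dots> \<le> ennreal (1 / r)"
  proof -
    \<comment> \<open>An inequality only, because \<open>1 / s * s = 0\<close> for \<open>s = 0\<close> and \<open>s = \<infinity>\<close>.\<close>
    have "1 / s * s \<le> 1"
      by (cases "s = 0 \<or> s = top") (auto simp: ennreal_divide_times ennreal_divide_self top.not_eq_extremum)
    then show ?thesis
      by (metis mult.assoc mult_1 mult_right_mono zero_le)
  qed
  finally show ?thesis .
qed

text \<open>\<open>L x\<close> is dominated by \<open>B\<close> times the indicator of the union of
  the cells, each of mass at most \<open>1 / r\<close>. The point \<open>x\<close> ranges over the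
  whole space, and the bound depends neither on it nor on \<open>K\<close> and \<mu>.\<close>

lemma nn_integral_rescaled_extension_le:
  assumes cover: "covered_by_cells L r N A" and r: "0 < r"
    and supp: "\<And>y. y \<notin> A \<Longrightarrow> L x y = 0"
  shows "(\<integral>\<^sup>+ y. ennreal (L x y) \<partial>rescaled_extension L K \<mu>) \<le> ennreal (B * (real N / r))"
proof -
  let ?R = "rescaled_extension L K \<mu>"
  obtain U where U: "A \<subseteq> (\<Union>i\<in>{1..N}. U i)" "\<And>i. i \<in> {1..N} \<Longrightarrow> open (U i)"
    "\<And>i x y. i \<in> {1..N} \<Longrightarrow> x \<in> U i \<Longrightarrow> y \<in> U i \<Longrightarrow> r < L x y"
    using cover unfolding covered_by_cells_def by blast
  have B: "0 \<le> B" using L_nonneg L_le order_trans by blast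
  have Us: "U i \<in> sets ?R" if "i \<in> {1..N}" for i
    using U(2)[OF that] by (simp add: rescaled_extension_def)
  have "(\<integral>\<^sup>+ y. ennreal (L x y) \<partial>?R) \<le> (\<integral>\<^sup>+ y. ennreal B * indicator (\<Union>i\<in>{1..N}. U i) y \<partial>?R)"
  proof (rule nn_integral_mono)
    fix y
    show "ennreal (L x y) \<le> ennreal B * indicator (\<Union>i\<in>{1..N}. U i) y"
      using supp[of y] U(1) L_le[of x y] by (cases "y \<in> A") (auto simp: indicator_def intro: ennreal_leI)
  qed
  also have "\<dots> = ennreal B * emeasure ?R (\<Union>i\<in>{1..N}. U i)"
    using Us by (intro nn_integral_cmult_indicator) auto
  also have "\<dots> \<le> ennreal B * (\<Sum>i\<in>{1..N}. emeasure ?R (U i))"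
    using Us by (intro mult_left_mono emeasure_subadditive_finite) auto
  also have "\<dots> \<le> ennreal B * (\<Sum>i\<in>{1..N}. ennreal (1 / r))"
    using U r by (intro mult_left_mono sum_mono cell_mass_le) auto
  also have "(\<Sum>i\<in>{1..N}. ennreal (1 / r)) = ennreal (real N / r)"
    using r by (subst sum_ennreal) auto
  also have "ennreal B * \<dots> = ennreal (B * (real N / r))"
    using r B by (intro ennreal_mult[symmetric]) auto
  finally show ?thesis .
qed

end

section \<open>Passage to the vague limit\<close>

lemma borel_measure_compact_finite:
  assumes "borel_measure M" "compact A"
  shows "emeasure M A < \<infinity>"
proof -
  have "\<exists>U. open U \<and> x \<in> U \<and> emeasure M U < \<infinity>" for x
    using assms(1) by (simp add: borel_measure_def locally_finite_measure_def)
  then obtain U where U: "\<And>x. open (U x)" "\<And>x. x \<in> U x" "\<And>x. emeasure M (U x) < \<infinity>" by metis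
  have "A \<subseteq> (\<Union>x\<in>A. U x)" using U(2) by blast
  from compactE_image[OF assms(2) U(1) this]
  obtain D where D: "finite D" "A \<subseteq> (\<Union>x\<in>D. U x)" by metis
  have Us: "U x \<in> sets M" for x using U(1) assms(1) by (simp add: borel_measure_def)
  have "emeasure M A \<le> emeasure M (\<Union>x\<in>D. U x)"
    using D Us by (intro emeasure_mono) auto
  also have "\<dots> \<le> (\<Sum>x\<in>D. emeasure M (U x))"
    using D Us by (intro emeasure_subadditive_finite) auto
  also have "\<dots> < \<infinity>" using D(1) U(3) by simp
  finally show ?thesis .
qed

theorem lemma4p7:
  fixes L :: "'a::{second_countable_topology, t2_space} \<Rightarrow> 'a \<Rightarrow> real"
    and Kx :: "'a \<Rightarrow> 'a set"
    and c :: real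
    and C :: ennreal
    and \<rho> :: "'a measure"
  assumes "locally_compact_space (euclidean :: 'a topology)"
    and "lagrangian L"
    and "continuous_on UNIV (\<lambda>(x, y). L x y)"
    and "compact_range L"
    and "\<And>x. compact (Kx x)"
    and "\<And>x y. y \<notin> Kx x \<Longrightarrow> L x y = 0"
    and "c = (INF x. L x x)" and "c > 0"
    and "(SUP (x, y). ennreal (L x y)) \<le> C" and "C < \<infinity>"
    and "\<exists>N>0. \<forall>x. covered_by_cells L (c / 2) N (Kx x)"
    and "borel_measure \<rho>"
    and "obtained_by_exhaustion L \<rho>"
  shows "(\<forall>x. integrable \<rho> (\<lambda>y. L x y)) \<and> (SUP x. \<integral>\<^sup>+ y. ennreal (L x y) \<partial>\<rho>) < \<infinity>"
proof -
  define B where "B = enn2real C"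
  have nonneg: "0 \<le> L x y" and sym: "L x y = L y x" for x y
    using assms(2) by (auto simp: lagrangian_def)
  have CB: "C = ennreal B" "0 \<le> B" using assms(10) by (auto simp: B_def)
  have le: "L x y \<le> B" for x y
  proof -
    have "ennreal (L x y) \<le> (SUP (x, y). ennreal (L x y))"
      by (rule SUP_upper2[of "(x, y)"]) auto
    then show ?thesis using assms(9) CB by (metis ennreal_le_iff order_trans)
  qed
  have meas: "(\<lambda>(x, y). L x y) \<in> borel_measurable borel"
    by (rule borel_measurable_continuous_onI) fact
  obtain N where cover: "\<And>x. covered_by_cells L (c / 2) N (Kx x)" using assms(11) by blast
  obtain K :: "nat \<Rightarrow> 'a set" and \<mu> and r :: "nat \<Rightarrow> nat"
    where min: "\<forall>n. action_minimizer L (K n) (\<mu> n)"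
    and lim: "vague_limit (\<lambda>k. rescaled_extension L (K (r k)) (\<mu> (r k))) \<rho>"
    using assms(13) unfolding obtained_by_exhaustion_def Let_def by blast
  \<comment> \<open>The cell bound with \<open>r = c / 2\<close>, that is,
    \<open>2 * N * B / c\<close>.\<close>
  define D where "D = B * (real N / (c / 2))"
  have D0: "0 \<le> D" using CB assms(8) by (simp add: D_def)
  have cont: "continuous_on UNIV (L x)" for x
  proof -
    have "continuous_on UNIV (\<lambda>y. (x, y))" by (intro continuous_intros)
    from continuous_on_compose2[OF assms(3) this] show ?thesis by simp
  qed
  have sets_\<rho>: "sets \<rho> = sets borel" using assms(12) by (simp add: borel_measure_def)
  have int: "integrable \<rho> (L x)" for x
  proof (rule integrableI_bounded_set)
    show "Kx x \<in> sets \<rho>" using assms(5) by (simp add: sets_\<rho> compact_imp_closed)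
    show "L x \<in> borel_measurable \<rho>"
      using borel_measurable_continuous_onI[OF cont] measurable_cong_sets[OF sets_\<rho> refl] by blast
    show "emeasure \<rho> (Kx x) < \<infinity>" using borel_measure_compact_finite assms(5,12) by blast
    show "AE y in \<rho>. y \<in> Kx x \<longrightarrow> norm (L x y) \<le> B" using nonneg le by simp
    show "AE y in \<rho>. y \<notin> Kx x \<longrightarrow> L x y = 0" using assms(6) by simp
  qed
  have bound: "(\<integral>\<^sup>+ y. ennreal (L x y) \<partial>\<rho>) \<le> ennreal D" for x
  proof -
    \<comment> \<open>This makes \<open>L x\<close> an admissible test function for vague
      convergence.\<close>
    have "closure {y. L x y \<noteq> 0} \<subseteq> Kx x"
      using assms(6) by (intro closure_minimal) (auto simp: assms(5) compact_imp_closed)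
    then have "compact (closure {y. L x y \<noteq> 0})"
      using compact_Int_closed[OF assms(5)[of x] closed_closure] by (metis inf.absorb2)
    then have "(\<lambda>k. \<integral>y. L x y \<partial>rescaled_extension L (K (r k)) (\<mu> (r k))) \<longlonglongrightarrow> (\<integral>y. L x y \<partial>\<rho>)"
      using lim cont unfolding vague_limit_def by blast
    then have "(\<integral>y. L x y \<partial>\<rho>) \<le> D"
    proof (rule LIMSEQ_le_const2, intro exI allI impI)
      fix k
      have "(\<integral>\<^sup>+ y. ennreal (L x y) \<partial>rescaled_extension L (K (r k)) (\<mu> (r k))) \<le> ennreal D"
        unfolding D_def
        by (rule nn_integral_rescaled_extension_le[OF nonneg sym le meas spec[OF min] cover])
          (use assms(6,8) in auto)
      then show "(\<integral>y. L x y \<partial>rescaled_extension L (K (r k)) (\<mu> (r k))) \<le> D"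
        \<comment> \<open>\<open>D0\<close> also covers the default value 0 of the Bochner
          integral.\<close>
        by (rule integral_real_bounded[OF D0])
    qed
    \<comment> \<open>Integrability excludes that default value for \<rho>, so the bound carries
      over to the nonnegative integral.\<close>
    then show ?thesis
      using nn_integral_eq_integral[OF int] nonneg by (simp add: ennreal_leI)
  qed
  have "(SUP x. \<integral>\<^sup>+ y. ennreal (L x y) \<partial>\<rho>) \<le> ennreal D"
    using bound by (intro SUP_least) auto
  then have "(SUP x. \<integral>\<^sup>+ y. ennreal (L x y) \<partial>\<rho>) < \<infinity>"
    by (simp add: le_less_trans)
  then show ?thesis using int by simp
qed

end
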